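(* Let $\mathcal{A}$ be a sixth order three dimensional quasi-truncated Hankel tensor with generating vector $\mathbf{v} = (v_0, v_1, 0,0,0,0, v_6, 0,0,0,0, v_{11}, v_{12})^\top \in \mathbb{R}^{13}$. Suppose that $v_0, v_6, v_{12} > 0$. If there exist $t_1, t_2 > 0$ such that $$|v_1| \le \frac{1}{t_1} - \frac{10 v_6}{t_1\sqrt{v_0 v_{12}}},$$ $$|v_{11}| \le \frac{1}{t_2} - \frac{10 v_6}{t_2\sqrt{v_0 v_{12}}},$$ $$|v_1|\left(\frac{5}{t_1 v_0}\right)^5 + |v_{11}|\left(\frac{5}{t_2 v_{12}}\right)^5 \le \frac{\sqrt{70}-8}{2}\, v_6$$ and $$\left(v_0 - 10 v_6\left(\frac{v_0}{v_{12}}\right)^{1/2} - |v_1| t_1 v_0\right)\left(v_{12} - 10 v_6\left(\frac{v_{12}}{v_0}\right)^{1/2} - |v_{11}| t_2 v_{12}\right)\left(\frac{\sqrt{70}-8}{2}\, v_6 - |v_1|\left(\frac{5}{t_1 v_0}\right)^5 - |v_{11}|\left(\frac{5}{t_2 v_{12}}\right)^5\right) \ge \frac{1}{27}\, v_6^3\, (60 + 15\sqrt{70})^3$$ hold, then $\mathcal{A}$ is SOS.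
   Context: The sixth order three dimensional Hankel tensor with generating vector $\mathbf{v}=(v_0,\ldots,v_{12})^\top$ is the real symmetric tensor $\mathcal{A}=(a_{i_1\cdots i_6})$ with $a_{i_1\cdots i_6}=v_{i_1+\cdots+i_6-6}$ for $i_1,\ldots,i_6\in\{1,2,3\}$; it is called quasi-truncated if all entries of $\mathbf{v}$ other than $v_0,v_1,v_6,v_{11},v_{12}$ are zero. The tensor $\mathcal{A}$ is SOS if $f(\mathbf{x})=\sum_{i_1,\ldots,i_6=1}^3 a_{i_1\cdots i_6}x_{i_1}\cdots x_{i_6}$ is a finite sum of squares of real homogeneous polynomials of degree $3$. *)

theory Defs
  imports Complex_Main "HOL-Library.FuncSet"
begin

text \<open>
  Vectors of \<open>\<real>\<^sup>n\<close> are functions \<open>x :: nat \<Rightarrow> real\<close> read at the coordinates \<open>1, \<dots>, n\<close> only.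
  A tensor of order \<open>m\<close> and dimension \<open>n\<close> is a function on the lists
  \<open>[i\<^sub>1, \<dots>, i\<^sub>m]\<close> with entries in \<open>{1..n}\<close>; its values on other lists are irrelevant.
\<close>

definition tensor_indices :: "nat \<Rightarrow> nat \<Rightarrow> nat list set" where
  "tensor_indices m n = {is. length is = m \<and> set is \<subseteq> {1..n}}"

definition tensor_form :: "nat \<Rightarrow> nat \<Rightarrow> (nat list \<Rightarrow> real) \<Rightarrow> (nat \<Rightarrow> real) \<Rightarrow> real" where
  "tensor_form m n A x = (\<Sum>is\<in>tensor_indices m n. A is * prod_list (map x is))"

text \<open>
  The generating vector has the entries \<open>v 0, \<dots>, v ((n - 1) * m)\<close>. The subtraction below does not
  truncate, since all indices are at least 1.
\<close>

definition hankel_tensor :: "nat \<Rightarrow> nat \<Rightarrow> (nat \<Rightarrow> real) \<Rightarrow> (nat list \<Rightarrow> real) \<Rightarrow> bool" where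
  "hankel_tensor m n v A \<longleftrightarrow> (\<forall>is\<in>tensor_indices m n. A is = v (sum_list is - m))"

definition quasi_truncated_hankel :: "(nat \<Rightarrow> real) \<Rightarrow> (nat list \<Rightarrow> real) \<Rightarrow> bool" where
  "quasi_truncated_hankel v A \<longleftrightarrow>
     hankel_tensor 6 3 v A \<and> (\<forall>k\<le>12. k \<notin> {0, 1, 6, 11, 12} \<longrightarrow> v k = 0)"

text \<open>
  Real polynomials in \<open>n\<close> variables are identified with their polynomial functions. The exponent
  vectors of the monomials of degree \<open>d\<close> are those \<open>\<alpha>\<close> with \<open>\<alpha> 1 + \<dots> + \<alpha> n = d\<close>; the bound by
  \<open>d\<close> on each exponent is implied and makes finiteness of the index set evident.
\<close>

definition homogeneous_polynomial :: "nat \<Rightarrow> nat \<Rightarrow> ((nat \<Rightarrow> real) \<Rightarrow> real) \<Rightarrow> bool" where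
  "homogeneous_polynomial n d p \<longleftrightarrow>
     (\<exists>c :: (nat \<Rightarrow> nat) \<Rightarrow> real. \<forall>x.
        p x = (\<Sum>\<alpha> \<in> {\<alpha> \<in> {1..n} \<rightarrow>\<^sub>E {0..d}. (\<Sum>i=1..n. \<alpha> i) = d}. c \<alpha> * (\<Prod>i=1..n. x i ^ \<alpha> i)))"

definition sos_tensor :: "nat \<Rightarrow> nat \<Rightarrow> (nat list \<Rightarrow> real) \<Rightarrow> bool" where
  "sos_tensor m n A \<longleftrightarrow>
     even m \<and>
     (\<exists>(N::nat) (q :: nat \<Rightarrow> (nat \<Rightarrow> real) \<Rightarrow> real).
        (\<forall>j<N. homogeneous_polynomial n (m div 2) (q j)) \<and>
        (\<forall>x. tensor_form m n A x = (\<Sum>j<N. (q j x)\<^sup>2)))"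

end

theory Submission
  imports Defs
begin

text \<open>
  Write \<open>x, y, z\<close> for the coordinates \<open>1, 2, 3\<close>. Collecting the entries of \<open>A\<close> by their index sum,
  the form of the tensor is
  \<open>v\<^sub>0 x^6 + 6 v\<^sub>1 x^5 y + v\<^sub>6 (y^6 + 30 x y^4 z + 90 x^2 y^2 z^2 + 20 x^3 z^3) + 6 v\<^sub>1\<^sub>1 y z^5 + v\<^sub>1\<^sub>2 z^6\<close>.
  The terms \<open>30 x y^4 z\<close> and \<open>90 x^2 y^2 z^2\<close>, with a multiple of \<open>y^6\<close>, are to become a square, for which
  \<open>90\<close> is too small a coefficient. The other mixed terms \<open>20 v\<^sub>6 x^3 z^3\<close>, \<open>6 v\<^sub>1 x^5 y\<close> and
  \<open>6 v\<^sub>1\<^sub>1 y z^5\<close> are absorbed by shares of the pure powers: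

  \<^item> with \<open>\<rho> = sqrt (v\<^sub>0 / v\<^sub>1\<^sub>2)\<close>, the term \<open>20 v\<^sub>6 x^3 z^3\<close> is completed to
    \<open>(10 v\<^sub>6 / \<rho>) (\<rho> x^3 + z^3)^2\<close>, which uses up \<open>10 v\<^sub>6 \<rho> x^6\<close> and \<open>(10 v\<^sub>6 / \<rho>) z^6\<close>;
  \<^item> with \<open>s = t\<^sub>1 v\<^sub>0\<close>, the term \<open>6 v\<^sub>1 x^5 y\<close> is completed to
    \<open>\<bar>v\<^sub>1\<bar> s x^6 + 6 v\<^sub>1 x^5 y + \<bar>v\<^sub>1\<bar> (5 / s)^5 y^6\<close>. This is the equality case of the inequality of
    arithmetic and geometric means for five copies of \<open>x^6\<close> and one of \<open>y^6\<close>, and the binary form is an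
    explicit sum of squares (\<open>sos_form_quintic_cross_term\<close>). The term \<open>6 v\<^sub>1\<^sub>1 y z^5\<close> is treated alike.

  What is left of \<open>y^6\<close> is split as \<open>b + \<kappa> v\<^sub>6\<close> with \<open>\<kappa> = (10 - sqrt 70) / 2\<close>, where \<open>b\<close> is the third
  factor in the last hypothesis; its first two factors \<open>a\<close> and \<open>c\<close> are what is left of \<open>x^6\<close>
  and \<open>z^6\<close>. The first three inequalities make \<open>a, b, c\<close> nonnegative, and the last one says that
  \<open>27 a b c \<ge> M^3\<close> for \<open>M = (60 + 15 sqrt 70) v\<^sub>6\<close>, so that \<open>a x^6 + b y^6 + c z^6 - M x^2 y^2 z^2\<close> is a
  sum of squares, again by arithmetic and geometric means (\<open>sos_form_am_gm\<close>).
  The summand \<open>M x^2 y^2 z^2\<close> gained here makes up what the \<open>90 x^2 y^2 z^2\<close> lacks: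
  \<open>\<kappa> y^6 + 30 x y^4 z + (150 + 15 sqrt 70) x^2 y^2 z^2\<close> is
  \<open>(1 / \<kappa>) (\<kappa> y^3 + 15 x y z)^2\<close>, since \<open>\<kappa> (150 + 15 sqrt 70) = 15^2\<close>.
\<close>

section \<open>Homogeneous polynomials\<close>

lemma homogeneous_polynomial_add:
  assumes "homogeneous_polynomial n d p" "homogeneous_polynomial n d q"
  shows "homogeneous_polynomial n d (\<lambda>x. p x + q x)"
proof -
  let ?I = "{\<alpha> \<in> {1..n} \<rightarrow>\<^sub>E {0..d}. (\<Sum>i=1..n. \<alpha> i) = d}"
  from assms obtain b c where
    b: "\<And>x. p x = (\<Sum>\<alpha>\<in>?I. b \<alpha> * (\<Prod>i=1..n. x i ^ \<alpha> i))" and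
    c: "\<And>x. q x = (\<Sum>\<alpha>\<in>?I. c \<alpha> * (\<Prod>i=1..n. x i ^ \<alpha> i))"
    unfolding homogeneous_polynomial_def by blast
  show ?thesis
    unfolding homogeneous_polynomial_def
    by (rule exI[of _ "\<lambda>\<alpha>. b \<alpha> + c \<alpha>"]) (simp add: b c sum.distrib distrib_right)
qed

lemma homogeneous_polynomial_scale:
  assumes "homogeneous_polynomial n d p"
  shows "homogeneous_polynomial n d (\<lambda>x. r * p x)"
proof -
  let ?I = "{\<alpha> \<in> {1..n} \<rightarrow>\<^sub>E {0..d}. (\<Sum>i=1..n. \<alpha> i) = d}"
  from assms obtain b where
    b: "\<And>x. p x = (\<Sum>\<alpha>\<in>?I. b \<alpha> * (\<Prod>i=1..n. x i ^ \<alpha> i))"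
    unfolding homogeneous_polynomial_def by blast
  show ?thesis
    unfolding homogeneous_polynomial_def
    by (rule exI[of _ "\<lambda>\<alpha>. r * b \<alpha>"]) (simp add: b sum_distrib_left mult.assoc)
qed

lemma prod_list_map_eq_prod_count:
  fixes f :: "'a \<Rightarrow> 'b::comm_monoid_mult"
  assumes "finite S" "set xs \<subseteq> S"
  shows "prod_list (map f xs) = (\<Prod>i\<in>S. f i ^ count_list xs i)"
  using assms(2)
proof (induction xs)
  case (Cons a xs)
  then have "a \<in> S" by simp
  have "(\<Prod>i\<in>S. f i ^ count_list (a # xs) i)
      = (\<Prod>i\<in>S. (if i = a then f i else 1) * f i ^ count_list xs i)"
    by (rule prod.cong) auto
  also have "\<dots> = f a * (\<Prod>i\<in>S. f i ^ count_list xs i)"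
    using assms(1) \<open>a \<in> S\<close> by (simp add: prod.distrib)
  finally show ?case using Cons by simp
qed simp

text \<open>
  Reading a monomial as a list of variables spares the exponent vectors: the exponent of a variable
  is its number of occurrences.
\<close>

lemma homogeneous_polynomial_monomial:
  assumes "is \<in> tensor_indices d n"
  shows "homogeneous_polynomial n d (\<lambda>x. prod_list (map x is))"
proof -
  let ?I = "{\<alpha> \<in> {1..n} \<rightarrow>\<^sub>E {0..d}. (\<Sum>i=1..n. \<alpha> i) = d}"
  define \<alpha> where "\<alpha> = restrict (count_list is) {1..n}"
  have len: "length is = d" and sub: "set is \<subseteq> {1..n}"
    using assms by (auto simp: tensor_indices_def)
  have "(\<Sum>i=1..n. \<alpha> i) = (\<Sum>i=1..n. count_list is i)"
    by (simp add: \<alpha>_def)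
  also have "\<dots> = (\<Sum>i\<in>set is. count_list is i)"
    using sub by (intro sum.mono_neutral_right) (auto simp: count_list_0_iff)
  also have "\<dots> = d" by (simp add: sum_count_set len)
  finally have "(\<Sum>i=1..n. \<alpha> i) = d" .
  moreover have "\<alpha> \<in> {1..n} \<rightarrow>\<^sub>E {0..d}"
    using count_le_length[of "is"] len by (auto simp: \<alpha>_def)
  ultimately have mem: "\<alpha> \<in> ?I" by simp
  have fin: "finite ?I"
    by (rule finite_subset[of _ "{1..n} \<rightarrow>\<^sub>E {0..d}"]) (auto intro: finite_PiE)
  have "prod_list (map x is) = (\<Sum>\<beta>\<in>?I. (if \<beta> = \<alpha> then 1 else 0) * (\<Prod>i=1..n. x i ^ \<beta> i))"
    for x :: "nat \<Rightarrow> real"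
  proof -
    have "(\<Sum>\<beta>\<in>?I. (if \<beta> = \<alpha> then 1 else 0) * (\<Prod>i=1..n. x i ^ \<beta> i))
        = (\<Sum>\<beta>\<in>?I. if \<beta> = \<alpha> then (\<Prod>i=1..n. x i ^ \<beta> i) else 0)"
      by (rule sum.cong) auto
    also have "\<dots> = (\<Prod>i=1..n. x i ^ \<alpha> i)"
      using mem by (simp only: sum.delta[OF fin] if_True)
    also have "\<dots> = (\<Prod>i=1..n. x i ^ count_list is i)"
      by (simp add: \<alpha>_def)
    also have "\<dots> = prod_list (map x is)"
      using prod_list_map_eq_prod_count[OF finite_atLeastAtMost sub, of x] by simp
    finally show ?thesis by simp
  qed
  then show ?thesis
    unfolding homogeneous_polynomial_def
    by (intro exI[of _ "\<lambda>\<beta>. if \<beta> = \<alpha> then 1 else 0"]) blast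
qed

lemma homogeneous_polynomial_cubic_monomial:
  assumes "i \<in> {1..n}" "j \<in> {1..n}" "k \<in> {1..n}"
  shows "homogeneous_polynomial n 3 (\<lambda>x. x i * x j * x k)"
  using homogeneous_polynomial_monomial[of "[i, j, k]" 3 n] assms
  by (simp add: tensor_indices_def mult.assoc)

text \<open>Every square used below is the square of a cubic binomial.\<close>

lemma homogeneous_polynomial_cubic_binomial:
  assumes "{i, j, k, i', j', k'} \<subseteq> {1..n}"
  shows "homogeneous_polynomial n 3 (\<lambda>x. r * (x i * x j * x k) + s * (x i' * x j' * x k'))"
  using assms
  by (intro homogeneous_polynomial_add homogeneous_polynomial_scale
      homogeneous_polynomial_cubic_monomial) auto

section \<open>The cone of sums of squares\<close>

definition sos_form :: "nat \<Rightarrow> nat \<Rightarrow> ((nat \<Rightarrow> real) \<Rightarrow> real) \<Rightarrow> bool" where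
  "sos_form n d f \<longleftrightarrow>
     (\<exists>(N::nat) q. (\<forall>j<N. homogeneous_polynomial n d (q j)) \<and> (\<forall>x. f x = (\<Sum>j<N. (q j x)\<^sup>2)))"

lemma sos_tensor_iff_sos_form: "sos_tensor m n A \<longleftrightarrow> even m \<and> sos_form n (m div 2) (tensor_form m n A)"
  by (simp add: sos_tensor_def sos_form_def)

lemma sos_form_square:
  assumes "homogeneous_polynomial n d p"
  shows "sos_form n d (\<lambda>x. (p x)\<^sup>2)"
  unfolding sos_form_def
  by (rule exI[of _ 1], rule exI[of _ "\<lambda>_. p"]) (use assms in simp)

lemma sos_form_add:
  assumes "sos_form n d f" "sos_form n d g"
  shows "sos_form n d (\<lambda>x. f x + g x)"
proof -
  obtain N :: nat and p where p: "\<And>j. j < N \<Longrightarrow> homogeneous_polynomial n d (p j)"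
    and f: "\<And>x. f x = (\<Sum>j<N. (p j x)\<^sup>2)"
    using assms(1) unfolding sos_form_def by blast
  obtain K :: nat and q where q: "\<And>j. j < K \<Longrightarrow> homogeneous_polynomial n d (q j)"
    and g: "\<And>x. g x = (\<Sum>j<K. (q j x)\<^sup>2)"
    using assms(2) unfolding sos_form_def by blast
  define r where "r j = (if j < N then p j else q (j - N))" for j
  have "f x + g x = (\<Sum>j<N + K. (r j x)\<^sup>2)" for x
  proof -
    have "(\<Sum>j<N + K. (r j x)\<^sup>2) = (\<Sum>j<N. (r j x)\<^sup>2) + (\<Sum>j<K. (r (N + j) x)\<^sup>2)"
      by (induction K) simp_all
    then show ?thesis by (simp add: r_def f g)
  qed
  moreover have "homogeneous_polynomial n d (r j)" if "j < N + K" for j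
    using that p q by (auto simp: r_def)
  ultimately show ?thesis unfolding sos_form_def by blast
qed

lemma sos_form_scale:
  assumes "sos_form n d f" "c \<ge> 0"
  shows "sos_form n d (\<lambda>x. c * f x)"
proof -
  obtain N :: nat and p where p: "\<And>j. j < N \<Longrightarrow> homogeneous_polynomial n d (p j)"
    and f: "\<And>x. f x = (\<Sum>j<N. (p j x)\<^sup>2)"
    using assms(1) unfolding sos_form_def by blast
  show ?thesis
    unfolding sos_form_def
    by (rule exI[of _ N], rule exI[of _ "\<lambda>j x. sqrt c * p j x"])
      (use assms(2) p in \<open>simp add: f homogeneous_polynomial_scale power_mult_distrib sum_distrib_left\<close>)
qed

lemma sos_form_cubic_binomial_square:
  assumes "{i, j, k, i', j', k'} \<subseteq> {1..n}" "c \<ge> 0"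
  shows "sos_form n 3 (\<lambda>x. c * (r * (x i * x j * x k) + s * (x i' * x j' * x k'))\<^sup>2)"
  using assms
  by (intro sos_form_scale sos_form_square homogeneous_polynomial_cubic_binomial)

section \<open>Two sextics that are nonnegative by arithmetic and geometric means\<close>

text \<open>
  With \<open>u = x i\<close> and \<open>w = r * x j\<close> the form is \<open>5 u^6 + 6 u^5 w + w^6\<close>. It has the double root \<open>w = - u\<close>,
  and the cofactor \<open>5 u^4 - 4 u^3 w + 3 u^2 w^2 - 2 u w^3 + w^4\<close> of \<open>(u + w)^2\<close> equals
  \<open>w^2 (w - u)^2 + 2 u^2 (w - u)^2 + 3 u^4\<close>.
\<close>

lemma sos_form_binary_sextic:
  assumes "i \<in> {1..n}" "j \<in> {1..n}"
  shows "sos_form n 3 (\<lambda>x. 5 * x i ^ 6 + 6 * r * x i ^ 5 * x j + r ^ 6 * x j ^ 6)"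
proof -
  have "sos_form n 3 (\<lambda>x.
      1 * (r ^ 3 * (x j * x j * x j) + - r * (x i * x i * x j))\<^sup>2
    + 2 * (r\<^sup>2 * (x i * x j * x j) + - 1 * (x i * x i * x i))\<^sup>2
    + 3 * (1 * (x i * x i * x i) + r * (x i * x i * x j))\<^sup>2)"
    using assms by (intro sos_form_add sos_form_cubic_binomial_square) auto
  also have "(\<lambda>x.
      1 * (r ^ 3 * (x j * x j * x j) + - r * (x i * x i * x j))\<^sup>2
    + 2 * (r\<^sup>2 * (x i * x j * x j) + - 1 * (x i * x i * x i))\<^sup>2
    + 3 * (1 * (x i * x i * x i) + r * (x i * x i * x j))\<^sup>2)
    = (\<lambda>x. 5 * x i ^ 6 + 6 * r * x i ^ 5 * x j + r ^ 6 * x j ^ 6)"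
    by (rule ext) algebra
  finally show ?thesis .
qed

text \<open>
  The price, in pure powers, of a cross term \<open>6 w (x i)^5 (x j)\<close> of either sign: the parameter \<open>s\<close>
  moves it between the two variables.
\<close>

lemma sos_form_quintic_cross_term:
  assumes "i \<in> {1..n}" "j \<in> {1..n}" "s > 0"
  shows "sos_form n 3 (\<lambda>x. \<bar>w\<bar> * s * x i ^ 6 + 6 * w * x i ^ 5 * x j + \<bar>w\<bar> * (5 / s) ^ 5 * x j ^ 6)"
proof -
  define r where "r = 5 / s"
  have r: "r > 0" "s = 5 / r" using assms(3) by (simp_all add: r_def)
  have "sos_form n 3 (\<lambda>x. \<bar>w\<bar> / r *
      (5 * x i ^ 6 + 6 * (sgn w * r) * x i ^ 5 * x j + (sgn w * r) ^ 6 * x j ^ 6))"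
    using assms r by (intro sos_form_scale sos_form_binary_sextic) auto
  also have "(\<lambda>x. \<bar>w\<bar> / r *
      (5 * x i ^ 6 + 6 * (sgn w * r) * x i ^ 5 * x j + (sgn w * r) ^ 6 * x j ^ 6))
    = (\<lambda>x. \<bar>w\<bar> * s * x i ^ 6 + 6 * w * x i ^ 5 * x j + \<bar>w\<bar> * (5 / s) ^ 5 * x j ^ 6)"
  proof
    fix x :: "nat \<Rightarrow> real"
    have "\<bar>w\<bar> / r * (6 * (sgn w * r) * x i ^ 5 * x j) = 6 * w * x i ^ 5 * x j"
      using r(1) by (cases w "0::real" rule: linorder_cases) simp_all
    moreover have "\<bar>w\<bar> / r * ((sgn w * r) ^ 6 * x j ^ 6) = \<bar>w\<bar> * r ^ 5 * x j ^ 6"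
      using r(1) by (cases w "0::real" rule: linorder_cases)
        (simp_all add: power_mult_distrib eval_nat_numeral)
    moreover have "\<bar>w\<bar> / r * (5 * x i ^ 6) = \<bar>w\<bar> * s * x i ^ 6"
      by (simp add: r(2))
    ultimately show "\<bar>w\<bar> / r *
        (5 * x i ^ 6 + 6 * (sgn w * r) * x i ^ 5 * x j + (sgn w * r) ^ 6 * x j ^ 6)
      = \<bar>w\<bar> * s * x i ^ 6 + 6 * w * x i ^ 5 * x j + \<bar>w\<bar> * (5 / s) ^ 5 * x j ^ 6"
      unfolding distrib_left r_def by metis
  qed
  finally show ?thesis .
qed

text \<open>
  For \<open>X = \<alpha> (x i)^2\<close>, \<open>Y = \<beta> (x j)^2\<close>, \<open>Z = \<gamma> (x k)^2\<close> with the cube roots \<open>\<alpha>, \<beta>, \<gamma>\<close> of the coefficients, this is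
  \<open>X^3 + Y^3 + Z^3 - 3 X Y Z = (X + Y + Z) ((X - Y)^2 + (Y - Z)^2 + (Z - X)^2) / 2\<close>. Each of the nine
  products on the right is a nonnegative multiple of the square of a cubic binomial, because \<open>X, Y, Z\<close>
  are nonnegative multiples of squares of variables.
\<close>

lemma sos_form_am_gm:
  assumes ijk: "i \<in> {1..n}" "j \<in> {1..n}" "k \<in> {1..n}"
    and nonneg: "a \<ge> 0" "b \<ge> 0" "c \<ge> 0" and le: "M ^ 3 \<le> 27 * (a * b * c)"
  shows "sos_form n 3 (\<lambda>x. a * x i ^ 6 + b * x j ^ 6 + c * x k ^ 6 - M * (x i * x j * x k)\<^sup>2)"
proof -
  define \<alpha> where "\<alpha> = root 3 a"
  define \<beta> where "\<beta> = root 3 b"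
  define \<gamma> where "\<gamma> = root 3 c"
  have pos: "\<alpha> \<ge> 0" "\<beta> \<ge> 0" "\<gamma> \<ge> 0"
    using nonneg by (simp_all add: \<alpha>_def \<beta>_def \<gamma>_def)
  have cube: "a = \<alpha> ^ 3" "b = \<beta> ^ 3" "c = \<gamma> ^ 3"
    using nonneg by (simp_all add: \<alpha>_def \<beta>_def \<gamma>_def)
  have "M ^ Suc 2 \<le> (3 * (\<alpha> * \<beta> * \<gamma>)) ^ Suc 2"
    using le by (simp add: cube power_mult_distrib)
  then have M: "M \<le> 3 * (\<alpha> * \<beta> * \<gamma>)"
    by (rule power_le_imp_le_base) (use pos in simp)
  have three: "sos_form n 3 (\<lambda>x.
        \<alpha> / 2 * (p * (x i * x l * x l) + q * (x i * x m * x m))\<^sup>2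
      + \<beta> / 2 * (p * (x j * x l * x l) + q * (x j * x m * x m))\<^sup>2
      + \<gamma> / 2 * (p * (x k * x l * x l) + q * (x k * x m * x m))\<^sup>2)"
    if "l \<in> {1..n}" "m \<in> {1..n}" for l m p q
    using that ijk pos by (intro sos_form_add sos_form_cubic_binomial_square) auto
  \<comment> \<open>The identity yields \<open>3 * \<alpha> * \<beta> * \<gamma>\<close> in place of \<open>M\<close>; the excess multiplies a square.\<close>
  have rest: "sos_form n 3 (\<lambda>x. (3 * (\<alpha> * \<beta> * \<gamma>) - M) *
      (1 * (x i * x j * x k) + 0 * (x i * x j * x k))\<^sup>2)"
    using ijk M by (intro sos_form_cubic_binomial_square) auto
  note sos = sos_form_add[OF sos_form_add[OF sos_form_add[OF
      three[OF ijk(1,2), of \<alpha> "- \<beta>"] three[OF ijk(2,3), of \<beta> "- \<gamma>"]]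
      three[OF ijk(3,1), of \<gamma> "- \<alpha>"]] rest]
  show ?thesis
    by (rule back_subst[of "sos_form n 3", OF sos], rule ext, unfold cube)
      (simp add: field_simps eval_nat_numeral)
qed

section \<open>The form of a Hankel tensor\<close>

lemma tensor_indices_0: "tensor_indices 0 n = {[]}"
  by (auto simp: tensor_indices_def)

lemma sum_tensor_indices_Suc:
  "(\<Sum>is\<in>tensor_indices (Suc m) n. F is) = (\<Sum>i=1..n. \<Sum>is\<in>tensor_indices m n. F (i # is))"
proof -
  have "(\<Sum>i=1..n. \<Sum>is\<in>tensor_indices m n. F (i # is))
      = (\<Sum>(i, is)\<in>{1..n} \<times> tensor_indices m n. F (i # is))"
    by (rule sum.cartesian_product)
  also have "\<dots> = (\<Sum>is\<in>tensor_indices (Suc m) n. F is)"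
    by (rule sum.reindex_bij_witness[of _ "\<lambda>is. (hd is, tl is)" "\<lambda>(i, is). i # is"])
      (auto simp: tensor_indices_def length_Suc_conv)
  finally show ?thesis by simp
qed

lemma length_le_sum_list_tensor_indices:
  assumes "is \<in> tensor_indices m n"
  shows "m \<le> sum_list is"
proof -
  have "set is \<subseteq> {1..n} \<Longrightarrow> length is \<le> sum_list is"
    by (induction "is") auto
  then show ?thesis using assms by (auto simp: tensor_indices_def)
qed

text \<open>
  Fixing the first index of a Hankel tensor leaves a Hankel tensor of lower order, whose generating
  vector is shifted by that index minus one. Carrying the shift \<open>s\<close> along makes this a recursion
  on the order.
\<close>

fun hankel_form :: "nat \<Rightarrow> nat \<Rightarrow> (nat \<Rightarrow> real) \<Rightarrow> nat \<Rightarrow> (nat \<Rightarrow> real) \<Rightarrow> real" where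
  "hankel_form 0 n v s x = v s"
| "hankel_form (Suc m) n v s x = (\<Sum>i=1..n. x i * hankel_form m n v (s + (i - 1)) x)"

lemma sum_tensor_indices_hankel:
  "(\<Sum>is\<in>tensor_indices m n. v (s + (sum_list is - m)) * prod_list (map x is)) = hankel_form m n v s x"
proof (induction m arbitrary: s)
  case 0
  show ?case by (simp add: tensor_indices_0)
next
  case (Suc m)
  have "(\<Sum>is\<in>tensor_indices m n. v (s + (sum_list (i # is) - Suc m)) * prod_list (map x (i # is)))
      = x i * hankel_form m n v (s + (i - 1)) x" if "i \<in> {1..n}" for i
  proof -
    have "s + (sum_list (i # is) - Suc m) = s + (i - 1) + (sum_list is - m)"
      if "is \<in> tensor_indices m n" for "is"
      using length_le_sum_list_tensor_indices[OF that] \<open>i \<in> {1..n}\<close> by simp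
    then show ?thesis
      unfolding Suc[of "s + (i - 1)", symmetric] sum_distrib_left
      by (intro sum.cong) (simp_all add: mult_ac add.assoc)
  qed
  then show ?case by (simp add: sum_tensor_indices_Suc)
qed

lemma tensor_form_hankel:
  assumes "hankel_tensor m n v A"
  shows "tensor_form m n A x = hankel_form m n v 0 x"
  using assms sum_tensor_indices_hankel[where s = 0 and v = v and m = m and n = n and x = x]
  by (simp add: tensor_form_def hankel_tensor_def)

lemma tensor_form_quasi_truncated_hankel:
  assumes "quasi_truncated_hankel v A"
  shows "tensor_form 6 3 A x =
    v 0 * x 1 ^ 6 + 6 * v 1 * x 1 ^ 5 * x 2
    + v 6 * (x 2 ^ 6 + 30 * x 1 * x 2 ^ 4 * x 3 + 90 * (x 1 * x 2 * x 3)\<^sup>2 + 20 * x 1 ^ 3 * x 3 ^ 3)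
    + 6 * v 11 * x 3 ^ 5 * x 2 + v 12 * x 3 ^ 6"
proof -
  have v: "v 2 = 0" "v 3 = 0" "v 4 = 0" "v 5 = 0" "v 7 = 0" "v 8 = 0" "v 9 = 0" "v 10 = 0"
    using assms by (auto simp: quasi_truncated_hankel_def)
  have step: "hankel_form (Suc m) 3 v s x =
      x 1 * hankel_form m 3 v s x + x 2 * hankel_form m 3 v (s + 1) x + x 3 * hankel_form m 3 v (s + 2) x"
    for m s
    by (simp add: eval_nat_numeral)
  have six: "hankel_form 6 = hankel_form (Suc (Suc (Suc (Suc (Suc (Suc 0))))))"
    by (simp add: eval_nat_numeral)
  have "tensor_form 6 3 A x = hankel_form 6 3 v 0 x"
    using assms by (simp add: quasi_truncated_hankel_def tensor_form_hankel)
  also have "\<dots> = v 0 * x 1 ^ 6 + 6 * v 1 * x 1 ^ 5 * x 2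
    + v 6 * (x 2 ^ 6 + 30 * x 1 * x 2 ^ 4 * x 3 + 90 * (x 1 * x 2 * x 3)\<^sup>2 + 20 * x 1 ^ 3 * x 3 ^ 3)
    + 6 * v 11 * x 3 ^ 5 * x 2 + v 12 * x 3 ^ 6"
    unfolding six step hankel_form.simps(1)
    by (simp add: v del: One_nat_def add_2_eq_Suc add_2_eq_Suc') algebra
  finally show ?thesis .
qed

section \<open>Quasi-truncated Hankel tensors\<close>

theorem proposition4:
  fixes v :: "nat \<Rightarrow> real" and A :: "nat list \<Rightarrow> real"
  assumes "quasi_truncated_hankel v A"
    and "v 0 > 0" and "v 6 > 0" and "v 12 > 0"
    and "\<exists>t1 t2 :: real. t1 > 0 \<and> t2 > 0 \<and>
      \<bar>v 1\<bar> \<le> 1 / t1 - 10 * v 6 / (t1 * sqrt (v 0 * v 12)) \<and>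
      \<bar>v 11\<bar> \<le> 1 / t2 - 10 * v 6 / (t2 * sqrt (v 0 * v 12)) \<and>
      \<bar>v 1\<bar> * (5 / (t1 * v 0)) ^ 5 + \<bar>v 11\<bar> * (5 / (t2 * v 12)) ^ 5
        \<le> (sqrt 70 - 8) / 2 * v 6 \<and>
      (v 0 - 10 * v 6 * (v 0 / v 12) powr (1 / 2) - \<bar>v 1\<bar> * t1 * v 0)
        * (v 12 - 10 * v 6 * (v 12 / v 0) powr (1 / 2) - \<bar>v 11\<bar> * t2 * v 12)
        * ((sqrt 70 - 8) / 2 * v 6 - \<bar>v 1\<bar> * (5 / (t1 * v 0)) ^ 5 - \<bar>v 11\<bar> * (5 / (t2 * v 12)) ^ 5)
        \<ge> 1 / 27 * (v 6) ^ 3 * (60 + 15 * sqrt 70) ^ 3"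
  shows "sos_tensor 6 3 A"
proof -
  from assms(5) obtain t1 t2 :: real where t: "t1 > 0" "t2 > 0"
    and h1: "\<bar>v 1\<bar> \<le> 1 / t1 - 10 * v 6 / (t1 * sqrt (v 0 * v 12))"
    and h2: "\<bar>v 11\<bar> \<le> 1 / t2 - 10 * v 6 / (t2 * sqrt (v 0 * v 12))"
    and h3: "\<bar>v 1\<bar> * (5 / (t1 * v 0)) ^ 5 + \<bar>v 11\<bar> * (5 / (t2 * v 12)) ^ 5 \<le> (sqrt 70 - 8) / 2 * v 6"
    and h4: "(v 0 - 10 * v 6 * (v 0 / v 12) powr (1 / 2) - \<bar>v 1\<bar> * t1 * v 0)
        * (v 12 - 10 * v 6 * (v 12 / v 0) powr (1 / 2) - \<bar>v 11\<bar> * t2 * v 12)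
        * ((sqrt 70 - 8) / 2 * v 6 - \<bar>v 1\<bar> * (5 / (t1 * v 0)) ^ 5 - \<bar>v 11\<bar> * (5 / (t2 * v 12)) ^ 5)
        \<ge> 1 / 27 * (v 6) ^ 3 * (60 + 15 * sqrt 70) ^ 3"
    by blast
  note pos = assms(2-4)
  define \<rho> where "\<rho> = sqrt (v 0 / v 12)"
  define \<kappa> where "\<kappa> = (10 - sqrt 70) / 2"
  define d1 where "d1 = \<bar>v 1\<bar> * (5 / (t1 * v 0)) ^ 5"
  define d2 where "d2 = \<bar>v 11\<bar> * (5 / (t2 * v 12)) ^ 5"
  define a where "a = v 0 - 10 * v 6 * \<rho> - \<bar>v 1\<bar> * (t1 * v 0)"
  define b where "b = (sqrt 70 - 8) / 2 * v 6 - d1 - d2"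
  define c where "c = v 12 - 10 * v 6 / \<rho> - \<bar>v 11\<bar> * (t2 * v 12)"
  define M where "M = (60 + 15 * sqrt 70) * v 6"
  have \<rho>: "\<rho> > 0" "(v 0 / v 12) powr (1 / 2) = \<rho>" "(v 12 / v 0) powr (1 / 2) = 1 / \<rho>"
    using pos by (simp_all add: \<rho>_def powr_half_sqrt real_sqrt_divide)
  have "sqrt 70 < sqrt (10\<^sup>2)" by (subst real_sqrt_less_iff) simp
  then have \<kappa>: "\<kappa> > 0" by (simp add: \<kappa>_def)
  have shares: "v 0 / sqrt (v 0 * v 12) = \<rho>" "v 12 / sqrt (v 0 * v 12) = 1 / \<rho>"
    using pos by (simp_all add: \<rho>_def real_sqrt_divide real_sqrt_mult field_simps)
  \<comment> \<open>The first two hypotheses, multiplied by \<open>t1 * v 0\<close> and \<open>t2 * v 12\<close>, bound the share of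
      \<open>x^6\<close> and \<open>z^6\<close> that is spent on the cross terms.\<close>
  have "\<bar>v 1\<bar> * (t1 * v 0) \<le> (1 / t1 - 10 * v 6 / (t1 * sqrt (v 0 * v 12))) * (t1 * v 0)"
    using h1 t pos by (intro mult_right_mono) auto
  also have "\<dots> = v 0 - 10 * v 6 * (v 0 / sqrt (v 0 * v 12))"
    using t by (simp add: field_simps)
  finally have "a \<ge> 0" by (simp add: a_def shares)
  have "\<bar>v 11\<bar> * (t2 * v 12) \<le> (1 / t2 - 10 * v 6 / (t2 * sqrt (v 0 * v 12))) * (t2 * v 12)"
    using h2 t pos by (intro mult_right_mono) auto
  also have "\<dots> = v 12 - 10 * v 6 * (v 12 / sqrt (v 0 * v 12))"
    using t by (simp add: field_simps)
  finally have "c \<ge> 0" by (simp add: c_def shares)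
  have "b \<ge> 0" using h3 by (simp add: b_def d1_def d2_def)
  have "M ^ 3 \<le> 27 * (a * b * c)"
    using h4 by (simp add: M_def a_def b_def c_def d1_def d2_def \<rho> power_mult_distrib mult_ac)
  have "sos_form 3 3 (\<lambda>x.
      10 * v 6 / \<rho> * (\<rho> * (x 1 * x 1 * x 1) + 1 * (x 3 * x 3 * x 3))\<^sup>2
    + (\<bar>v 1\<bar> * (t1 * v 0) * x 1 ^ 6 + 6 * v 1 * x 1 ^ 5 * x 2 + \<bar>v 1\<bar> * (5 / (t1 * v 0)) ^ 5 * x 2 ^ 6)
    + (\<bar>v 11\<bar> * (t2 * v 12) * x 3 ^ 6 + 6 * v 11 * x 3 ^ 5 * x 2 + \<bar>v 11\<bar> * (5 / (t2 * v 12)) ^ 5 * x 2 ^ 6)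
    + (a * x 1 ^ 6 + b * x 2 ^ 6 + c * x 3 ^ 6 - M * (x 1 * x 2 * x 3)\<^sup>2)
    + v 6 / \<kappa> * (\<kappa> * (x 2 * x 2 * x 2) + 15 * (x 1 * x 2 * x 3))\<^sup>2)"
    using pos t \<rho>(1) \<kappa> \<open>a \<ge> 0\<close> \<open>b \<ge> 0\<close> \<open>c \<ge> 0\<close> \<open>M ^ 3 \<le> 27 * (a * b * c)\<close>
    by (intro sos_form_add sos_form_cubic_binomial_square sos_form_quintic_cross_term sos_form_am_gm)
      auto
  also have "(\<lambda>x.
      10 * v 6 / \<rho> * (\<rho> * (x 1 * x 1 * x 1) + 1 * (x 3 * x 3 * x 3))\<^sup>2
    + (\<bar>v 1\<bar> * (t1 * v 0) * x 1 ^ 6 + 6 * v 1 * x 1 ^ 5 * x 2 + \<bar>v 1\<bar> * (5 / (t1 * v 0)) ^ 5 * x 2 ^ 6)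
    + (\<bar>v 11\<bar> * (t2 * v 12) * x 3 ^ 6 + 6 * v 11 * x 3 ^ 5 * x 2 + \<bar>v 11\<bar> * (5 / (t2 * v 12)) ^ 5 * x 2 ^ 6)
    + (a * x 1 ^ 6 + b * x 2 ^ 6 + c * x 3 ^ 6 - M * (x 1 * x 2 * x 3)\<^sup>2)
    + v 6 / \<kappa> * (\<kappa> * (x 2 * x 2 * x 2) + 15 * (x 1 * x 2 * x 3))\<^sup>2)
    = tensor_form 6 3 A"
  proof
    fix x :: "nat \<Rightarrow> real"
    have first: "10 * v 6 / \<rho> * (\<rho> * (x 1 * x 1 * x 1) + 1 * (x 3 * x 3 * x 3))\<^sup>2
        = 10 * v 6 * \<rho> * x 1 ^ 6 + 20 * v 6 * x 1 ^ 3 * x 3 ^ 3 + 10 * v 6 / \<rho> * x 3 ^ 6"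
      using \<rho>(1) by (simp add: field_simps eval_nat_numeral)
    have "\<kappa> * (150 + 15 * sqrt 70) = 225" by (simp add: \<kappa>_def field_simps)
    then have "225 / \<kappa> = 150 + 15 * sqrt 70" using \<kappa> by (simp add: field_simps)
    moreover have "v 6 / \<kappa> * (\<kappa> * (x 2 * x 2 * x 2) + 15 * (x 1 * x 2 * x 3))\<^sup>2
        = v 6 * (\<kappa> * x 2 ^ 6 + 30 * x 1 * x 2 ^ 4 * x 3 + 225 / \<kappa> * (x 1 * x 2 * x 3)\<^sup>2)"
      using \<kappa> by (simp add: field_simps eval_nat_numeral)
    ultimately have last: "v 6 / \<kappa> * (\<kappa> * (x 2 * x 2 * x 2) + 15 * (x 1 * x 2 * x 3))\<^sup>2
        = v 6 * (\<kappa> * x 2 ^ 6 + 30 * x 1 * x 2 ^ 4 * x 3 + (150 + 15 * sqrt 70) * (x 1 * x 2 * x 3)\<^sup>2)"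
      by simp
    have b: "b = v 6 - \<kappa> * v 6 - d1 - d2" by (simp add: b_def \<kappa>_def field_simps)
    show "10 * v 6 / \<rho> * (\<rho> * (x 1 * x 1 * x 1) + 1 * (x 3 * x 3 * x 3))\<^sup>2
    + (\<bar>v 1\<bar> * (t1 * v 0) * x 1 ^ 6 + 6 * v 1 * x 1 ^ 5 * x 2 + \<bar>v 1\<bar> * (5 / (t1 * v 0)) ^ 5 * x 2 ^ 6)
    + (\<bar>v 11\<bar> * (t2 * v 12) * x 3 ^ 6 + 6 * v 11 * x 3 ^ 5 * x 2 + \<bar>v 11\<bar> * (5 / (t2 * v 12)) ^ 5 * x 2 ^ 6)
    + (a * x 1 ^ 6 + b * x 2 ^ 6 + c * x 3 ^ 6 - M * (x 1 * x 2 * x 3)\<^sup>2)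
    + v 6 / \<kappa> * (\<kappa> * (x 2 * x 2 * x 2) + 15 * (x 1 * x 2 * x 3))\<^sup>2
    = tensor_form 6 3 A x"
      unfolding tensor_form_quasi_truncated_hankel[OF assms(1)] first last
        d1_def[symmetric] d2_def[symmetric]
      by (simp add: a_def b c_def M_def algebra_simps)
  qed
  finally show ?thesis by (simp add: sos_tensor_iff_sos_form)
qed

end
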